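(* Let $a>0$, $b\ge 0$, $L>0$, $U\in(0,L)$, and let $u$ be the solution with $u(0)=U$ and given initial velocity $u'(0)<0$ of $$u'=-\sqrt{\frac{a}{u}-\frac{b}{L-u}+C},\qquad C=u'^2(0)-\frac{a}{U}+\frac{b}{L-U}.$$ Assume $$u'^2(0)-\frac{a}{U}<0 .$$ Then the collapsing time $T_u$ of $u$ is less than the value $$\frac{1}{K^{1/2}\gamma^{3/2}}\left[\arcsin\sqrt{\gamma W}-\sqrt{\gamma W}\,\sqrt{1-\gamma W}\right],$$ where $$K=a,\qquad W=U,\qquad \beta=\frac{a}{U}-u'^2(0),\qquad \gamma=\frac{\beta}{K}.$$
   Context: The first-order equation is the energy-conservation form of the second-order problem $u''=-\frac{a}{2u^2}-\frac{b}{2(L-u)^2}$, $u(0)=U\in(0,L)$, $u'(0)<0$, which models a light body at position $u(t)\in(0,L)$ moving on a line between an attractor fixed at $0$ (mass $M>0$, $a=2GM$) and a repeller fixed at $L$ (negative mass $-M_*$ with $M_*\ge 0$, $b=2GM_*$), $G$ being the gravitational constant. The solution $u$ is decreasing and is continued forward in time until it vanishes, which happens in finite time; the collapsing time $T_u$ is the time at which $u$ vanishes. The value to which $T_u$ is compared is the exact collapsing time, without repeller, of the solution $w$ of $w'=-\sqrt{\frac{K}{w}-\beta}$, $w(0)=W$, where $\beta=\frac{K}{W}-w'^2(0)>0$.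
   Formalization: For b = 0 the collapsing time equals the stated value, so the strict inequality fails there; the formal theorem proves T_u at most the value for all b ≥ 0 and strictly less than it when b > 0. *)

theory Defs
  imports Complex_Main
begin

definition energy_const :: "real \<Rightarrow> real \<Rightarrow> real \<Rightarrow> real \<Rightarrow> real \<Rightarrow> real" where
  "energy_const a b L U v = v\<^sup>2 - a / U + b / (L - U)"

definition speed_sq :: "real \<Rightarrow> real \<Rightarrow> real \<Rightarrow> real \<Rightarrow> real \<Rightarrow> real \<Rightarrow> real" where
  "speed_sq a b L U v x = a / x - b / (L - x) + energy_const a b L U v"

text \<open>
  The solution is continued forward in time until it vanishes: at every time up to which
  \<open>u\<close> has stayed positive, \<open>u\<close> lies in \<open>(0, L)\<close> and satisfies the equation. Since \<open>u\<close> is a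
  total function, its values after the first zero are an arbitrary continuous extension
  (for instance \<open>0\<close>); no equation is imposed there. Nothing here presupposes that \<open>u\<close>
  ever vanishes. The radicand is required to be nonnegative because \<open>sqrt\<close> is also
  defined on negative numbers. The parameter \<open>v\<close> is the initial velocity.
\<close>

definition fall_solution ::
  "real \<Rightarrow> real \<Rightarrow> real \<Rightarrow> real \<Rightarrow> real \<Rightarrow> (real \<Rightarrow> real) \<Rightarrow> bool" where
  "fall_solution a b L U v u \<longleftrightarrow>
     continuous_on {0..} u \<and>
     u 0 = U \<and>
     (u has_real_derivative v) (at 0 within {0..}) \<and>
     (\<forall>t\<ge>0. (\<forall>s\<in>{0..t}. 0 < u s) \<longrightarrow>
        u t < L \<and>
        0 \<le> speed_sq a b L U v (u t) \<and>
        (u has_real_derivative - sqrt (speed_sq a b L U v (u t))) (at t within {0..}))"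

text \<open>
  The first zero of \<open>u\<close>. The infimum is meaningful only if \<open>u\<close> vanishes somewhere on
  \<open>[0, \<infinity>)\<close>.
\<close>

definition collapsing_time :: "(real \<Rightarrow> real) \<Rightarrow> real" where
  "collapsing_time u = Inf {t. 0 \<le> t \<and> u t = 0}"

end

theory Submission
  imports Defs "HOL-Analysis.Analysis"
begin

text \<open>
  Without a repeller the equation of motion is \<open>w' = - sqrt (K / w - \<beta>)\<close> with
  \<open>\<beta> = \<gamma> * K\<close>. Separating variables, the time needed to fall from height \<open>x\<close> to \<open>0\<close>
  is an antiderivative of \<open>1 / sqrt (K / x - \<beta>)\<close> that vanishes at \<open>0\<close>; this is the
  function \<open>free_fall_time K \<gamma>\<close> below, and the bound of the theorem is its value at the
  initial height \<open>U\<close>.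

  Along the solution \<open>u\<close> with repeller, consider
  \<open>G t = free_fall_time a \<gamma> (u t) + t\<close>: elapsed time plus the time that a fall without
  repeller would still take, at the energy that \<open>u\<close> has without the repeller's
  potential at time \<open>0\<close>. By energy conservation the squared speed of \<open>u\<close> at height
  \<open>x\<close> is \<open>a / x - \<beta> + (b / (L - U) - b / (L - x))\<close>. Since \<open>u\<close> falls, it stays below
  \<open>U\<close>, so the bracket is nonnegative, and positive if \<open>b > 0\<close>: moving away from the
  repeller only adds speed. Hence \<open>G\<close> is nonincreasing as long as \<open>u\<close> is positive,
  and strictly decreasing if \<open>b > 0\<close> (lemma \<open>fall_time_bound\<close>).

  If \<open>u\<close> were positive up to the time \<open>V = G 0\<close>, then \<open>G V > V = G 0\<close>, which is
  impossible; so \<open>u\<close> has a first zero \<open>T\<close>, and there \<open>T = G T \<le> G 0 = V\<close>, with strict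
  inequality if \<open>b > 0\<close>.
\<close>

definition free_fall_time :: "real \<Rightarrow> real \<Rightarrow> real \<Rightarrow> real" where
  "free_fall_time K \<gamma> x = 1 / (K powr (1/2) * \<gamma> powr (3/2)) *
      (arcsin (sqrt (\<gamma> * x)) - sqrt (\<gamma> * x) * sqrt (1 - \<gamma> * x))"

lemma free_fall_time_0 [simp]: "free_fall_time K \<gamma> 0 = 0"
  by (simp add: free_fall_time_def)

lemma continuous_on_free_fall_time:
  assumes "\<gamma> > 0" "\<gamma> * X \<le> 1"
  shows "continuous_on {0..X} (free_fall_time K \<gamma>)"
proof -
  have "0 \<le> \<gamma> * x \<and> \<gamma> * x \<le> 1" if "x \<in> {0..X}" for x
    using that assms order_trans[OF mult_left_mono[of x X \<gamma>], of 1] by simp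
  then have "\<forall>x\<in>{0..X}. - 1 \<le> sqrt (\<gamma> * x) \<and> sqrt (\<gamma> * x) \<le> 1"
    using real_sqrt_ge_zero by (force intro: order_trans[of _ 0])
  then show ?thesis
    unfolding free_fall_time_def by (intro continuous_intros)
qed

text \<open>
  With \<open>p = sqrt (\<gamma> * x)\<close> and \<open>q = sqrt (1 - \<gamma> * x)\<close>, the bracket has derivative
  \<open>\<gamma> * (1 - q\<^sup>2 + p\<^sup>2) / (2 * p * q)\<close>, and \<open>p\<^sup>2 + q\<^sup>2 = 1\<close> turns it into
  \<open>\<gamma> * p / q\<close>.
\<close>

lemma DERIV_free_fall_time:
  assumes "K > 0" "\<gamma> > 0" "x > 0" "\<gamma> * x < 1"
  shows "(free_fall_time K \<gamma> has_real_derivative 1 / sqrt (K / x - \<gamma> * K)) (at x)"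
proof -
  define p q where "p = sqrt (\<gamma> * x)" and "q = sqrt (1 - \<gamma> * x)"
  have pq: "p > 0" "q > 0" "p\<^sup>2 = \<gamma> * x" "q\<^sup>2 = 1 - \<gamma> * x"
    using assms by (auto simp: p_def q_def)
  have "p < 1"
    using assms by (simp add: p_def)
  have "((\<lambda>x. arcsin (sqrt (\<gamma> * x)) - sqrt (\<gamma> * x) * sqrt (1 - \<gamma> * x))
          has_real_derivative
          \<gamma> / (2 * p * q) - (\<gamma> * q / (2 * p) - \<gamma> * p / (2 * q))) (at x)"
  proof -
    have "((\<lambda>x. \<gamma> * x) has_real_derivative \<gamma>) (at x)"
      by (auto intro!: derivative_eq_intros)
    moreover have "0 < \<gamma> * x" "0 < 1 - \<gamma> * x"
      using assms by auto
    ultimately have "((\<lambda>x. sqrt (\<gamma> * x)) has_real_derivative inverse p / 2 * \<gamma>) (at x)"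
      unfolding p_def by (intro DERIV_chain2[OF DERIV_real_sqrt])
    then have dp: "((\<lambda>x. sqrt (\<gamma> * x)) has_real_derivative \<gamma> / (2 * p)) (at x)"
      by (simp add: field_simps)
    have "((\<lambda>x. 1 - \<gamma> * x) has_real_derivative - \<gamma>) (at x)"
      by (auto intro!: derivative_eq_intros)
    with \<open>0 < 1 - \<gamma> * x\<close>
    have "((\<lambda>x. sqrt (1 - \<gamma> * x)) has_real_derivative inverse q / 2 * - \<gamma>) (at x)"
      unfolding q_def by (intro DERIV_chain2[OF DERIV_real_sqrt])
    then have dq: "((\<lambda>x. sqrt (1 - \<gamma> * x)) has_real_derivative - (\<gamma> / (2 * q))) (at x)"
      by (simp add: field_simps)
    have "sqrt (1 - p\<^sup>2) = q"
      using pq(3) by (simp add: q_def)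
    then have "(arcsin has_real_derivative 1 / q) (at p)"
      using DERIV_arcsin[of p] \<open>p < 1\<close> \<open>p > 0\<close> by (simp add: inverse_eq_divide)
    then have "((\<lambda>x. arcsin (sqrt (\<gamma> * x))) has_real_derivative 1 / q * (\<gamma> / (2 * p))) (at x)"
      using dp unfolding p_def by (rule DERIV_chain2)
    from DERIV_diff[OF this DERIV_mult[OF dp dq]] show ?thesis
      by (rule DERIV_cong) (simp add: p_def[symmetric] q_def[symmetric])
  qed
  moreover have "\<gamma> / (2 * p * q) - (\<gamma> * q / (2 * p) - \<gamma> * p / (2 * q)) = \<gamma> * p / q"
  proof -
    have "\<gamma> / (2 * p * q) - (\<gamma> * q / (2 * p) - \<gamma> * p / (2 * q))
        = \<gamma> * (1 - q\<^sup>2 + p\<^sup>2) / (2 * p * q)"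
      using pq(1,2) by (simp add: field_simps power2_eq_square)
    also have "1 - q\<^sup>2 + p\<^sup>2 = 2 * p\<^sup>2"
      using pq(3,4) by simp
    finally show ?thesis
      using pq(1,2) by (simp add: power2_eq_square)
  qed
  ultimately have "((\<lambda>x. arcsin (sqrt (\<gamma> * x)) - sqrt (\<gamma> * x) * sqrt (1 - \<gamma> * x))
      has_real_derivative \<gamma> * p / q) (at x)"
    by simp
  then have "(free_fall_time K \<gamma> has_real_derivative
      1 / (K powr (1/2) * \<gamma> powr (3/2)) * (\<gamma> * p / q)) (at x)"
    unfolding free_fall_time_def by (rule DERIV_cmult)
  moreover have "1 / (K powr (1/2) * \<gamma> powr (3/2)) * (\<gamma> * p / q)
      = 1 / sqrt (K / x - \<gamma> * K)"
  proof -
    have "\<gamma> powr (3/2) = \<gamma> * sqrt \<gamma>"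
      using powr_add[of \<gamma> 1 "1/2"] assms by (simp add: powr_half_sqrt)
    moreover have "K / x - \<gamma> * K = K * (1 - \<gamma> * x) / x"
      using assms by (simp add: field_simps)
    then have "sqrt (K / x - \<gamma> * K) = sqrt K * q / sqrt x"
      by (simp add: q_def real_sqrt_mult real_sqrt_divide)
    moreover have "p = sqrt \<gamma> * sqrt x"
      by (simp add: p_def real_sqrt_mult)
    ultimately show ?thesis
      using assms by (simp add: powr_half_sqrt)
  qed
  ultimately show ?thesis
    by simp
qed

lemma free_fall_time_pos:
  assumes "K > 0" "\<gamma> > 0" "x > 0" "\<gamma> * x < 1"
  shows "free_fall_time K \<gamma> x > 0"
proof -
  have "free_fall_time K \<gamma> 0 < free_fall_time K \<gamma> x"
  proof (rule DERIV_pos_imp_increasing_open[OF \<open>x > 0\<close>])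
    fix z assume z: "0 < z" "z < x"
    then have "\<gamma> * z < 1"
      using assms mult_strict_left_mono[of z x \<gamma>] by linarith
    moreover from this have "K / z - \<gamma> * K > 0"
      using z assms by (simp add: field_simps)
    ultimately show "\<exists>y. (free_fall_time K \<gamma> has_real_derivative y) (at z) \<and> y > 0"
      using DERIV_free_fall_time[of K \<gamma> z] z assms by force
  qed (use assms in \<open>simp add: continuous_on_free_fall_time\<close>)
  then show ?thesis
    by simp
qed

text \<open>
  By the chain rule, the elapsed time plus the remaining free fall time has derivative
  \<open>1 - s / r\<close>, where \<open>s\<close> is the speed of \<open>u\<close> and \<open>r\<close> the speed of the fall without
  repeller at the same height; the repeller makes \<open>s \<ge> r\<close>.
  The times considered lie before the first zero, but \<open>T\<close> itself may be that zero: there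
  \<open>u\<close> has infinite speed, so only continuity is available at \<open>T\<close>.
\<close>

lemma fall_time_bound:
  assumes "a > 0" "b \<ge> 0" "0 < U" "U < L" "v < 0"
    and sol: "fall_solution a b L U v u"
    and \<gamma>: "\<gamma> = (a / U - v\<^sup>2) / a" "\<gamma> > 0"
    and T: "T > 0" "\<And>t. 0 \<le> t \<Longrightarrow> t < T \<Longrightarrow> u t > 0"
  shows "u T < U"
    and "free_fall_time a \<gamma> (u T) + T \<le> free_fall_time a \<gamma> U"
    and "b > 0 \<Longrightarrow> free_fall_time a \<gamma> (u T) + T < free_fall_time a \<gamma> U"
proof -
  define S where "S x = speed_sq a b L U v x" for x
  have cont: "continuous_on {0..t} u" for t
    using sol unfolding fall_solution_def by (auto intro: continuous_on_subset)
  have u0: "u 0 = U"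
    using sol by (simp add: fall_solution_def)
  have deriv: "(u has_real_derivative - sqrt (S (u t))) (at t)" and S0: "S (u t) \<ge> 0"
    if "0 < t" "t < T" for t
  proof -
    have pos: "\<forall>s\<in>{0..t}. 0 < u s"
      using T that by auto
    then have "S (u t) \<ge> 0 \<and> (u has_real_derivative - sqrt (S (u t))) (at t within {0..})"
      using sol \<open>0 < t\<close> unfolding fall_solution_def S_def by force
    moreover have "at t within {0..} = at t"
      using that by (intro at_within_interior) auto
    ultimately show "(u has_real_derivative - sqrt (S (u t))) (at t)" "S (u t) \<ge> 0"
      by simp_all
  qed
  have u_le: "u t \<le> U" if "0 \<le> t" "t \<le> T" for t
  proof -
    have "u t \<le> u 0"
    proof (rule DERIV_nonpos_imp_decreasing_open[OF \<open>0 \<le> t\<close>])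
      fix s assume "0 < s" "s < t"
      then show "\<exists>y. (u has_real_derivative y) (at s) \<and> y \<le> 0"
        using deriv[of s] S0[of s] that by (intro exI[of _ "- sqrt (S (u s))"]) auto
    qed (rule cont)
    then show ?thesis
      by (simp add: u0)
  qed
  have \<gamma>a: "\<gamma> * a = a / U - v\<^sup>2"
    using \<open>a > 0\<close> \<gamma> by simp
  have "v\<^sup>2 > 0"
    using \<open>v < 0\<close> by simp
  have R_pos: "0 < a / x - \<gamma> * a" if "0 < x" "x \<le> U" for x
  proof -
    have "a / U \<le> a / x"
      using that \<open>a > 0\<close> by (simp add: frac_le)
    then show ?thesis
      using \<gamma>a \<open>v\<^sup>2 > 0\<close> by linarith
  qed
  have \<gamma>U: "\<gamma> * U < 1"
    using \<gamma>a R_pos[of U] \<open>a > 0\<close> \<open>0 < U\<close> by (simp add: field_simps)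
  have S_eq: "S x = a / x - \<gamma> * a + (b / (L - U) - b / (L - x))" for x
    unfolding S_def speed_sq_def energy_const_def \<gamma>a by simp
  have S_ge: "a / x - \<gamma> * a \<le> S x" if "0 < x" "x \<le> U" for x
    using that assms by (simp add: S_eq frac_le)
  have S_gr: "a / x - \<gamma> * a < S x" if "0 < x" "x < U" "b > 0" for x
    using that assms by (simp add: S_eq frac_less2)
  \<comment> \<open>The bound \<open>u \<le> U\<close> keeps the speed away from zero, which in turn makes it strict.\<close>
  have u_less: "u t < U" if "0 < t" "t \<le> T" for t
  proof -
    have "u t < u 0"
    proof (rule DERIV_neg_imp_decreasing_open[OF \<open>0 < t\<close>])
      fix s assume s: "0 < s" "s < t"
      then have "S (u s) > 0"
        using R_pos[of "u s"] S_ge[of "u s"] T u_le[of s] that by force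
      then show "\<exists>y. (u has_real_derivative y) (at s) \<and> y < 0"
        using deriv[of s] s that by (intro exI[of _ "- sqrt (S (u s))"]) auto
    qed (rule cont)
    then show ?thesis
      by (simp add: u0)
  qed
  then show "u T < U"
    using T by simp
  have uT: "u T \<ge> 0"
  proof (rule ccontr)
    assume "\<not> ?thesis"
    then obtain s where "0 \<le> s" "s \<le> T" "u s = u T / 2"
      using IVT2'[of u T "u T / 2" 0] cont[of T] T(1) u0 \<open>0 < U\<close> by auto
    with \<open>\<not> ?thesis\<close> T(2)[of s] show False
      by (cases "s = T") auto
  qed
  define G where "G t = free_fall_time a \<gamma> (u t) + t" for t
  have G_cont: "continuous_on {0..T} G"
  proof -
    have "u ` {0..T} \<subseteq> {0..U}"
    proof
      fix y assume "y \<in> u ` {0..T}"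
      then obtain t where t: "t \<in> {0..T}" "y = u t"
        by auto
      then show "y \<in> {0..U}"
        using u_le[of t] T(2)[of t] uT by (cases "t = T") auto
    qed
    then have "continuous_on {0..T} (\<lambda>t. free_fall_time a \<gamma> (u t))"
      using \<gamma> \<gamma>U by (intro continuous_on_compose2[OF continuous_on_free_fall_time cont]) auto
    then show ?thesis
      unfolding G_def by (intro continuous_intros)
  qed
  have G_deriv: "(G has_real_derivative 1 - sqrt (S (u t)) / sqrt (a / u t - \<gamma> * a)) (at t)"
    if t: "0 < t" "t < T" for t
  proof -
    have "\<gamma> * u t < 1"
      using mult_left_mono[of "u t" U \<gamma>] \<gamma> \<gamma>U u_le[of t] t by simp
    then have "((\<lambda>t. free_fall_time a \<gamma> (u t)) has_real_derivative
        1 / sqrt (a / u t - \<gamma> * a) * - sqrt (S (u t))) (at t)"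
      using T t \<open>a > 0\<close> \<gamma>(2) deriv[OF t]
      by (intro DERIV_chain2[OF DERIV_free_fall_time]) auto
    then show ?thesis
      unfolding G_def by (auto intro!: derivative_eq_intros)
  qed
  have "G T \<le> G 0"
  proof (rule DERIV_nonpos_imp_decreasing_open[OF less_imp_le[OF T(1)]])
    fix t assume t: "0 < t" "t < T"
    then have "0 < a / u t - \<gamma> * a" "a / u t - \<gamma> * a \<le> S (u t)"
      using R_pos[of "u t"] S_ge[of "u t"] T u_le[of t] by auto
    then have "1 - sqrt (S (u t)) / sqrt (a / u t - \<gamma> * a) \<le> 0"
      by simp
    then show "\<exists>y. (G has_real_derivative y) (at t) \<and> y \<le> 0"
      using G_deriv[OF t] by blast
  qed (rule G_cont)
  then show "free_fall_time a \<gamma> (u T) + T \<le> free_fall_time a \<gamma> U"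
    by (simp add: G_def u0)
  show "free_fall_time a \<gamma> (u T) + T < free_fall_time a \<gamma> U" if "b > 0"
  proof -
    have "G T < G 0"
    proof (rule DERIV_neg_imp_decreasing_open[OF T(1)])
      fix t assume t: "0 < t" "t < T"
      then have "0 < a / u t - \<gamma> * a" "a / u t - \<gamma> * a < S (u t)"
        using R_pos[of "u t"] S_gr[of "u t"] T u_less[of t] \<open>b > 0\<close> by auto
      then have "1 - sqrt (S (u t)) / sqrt (a / u t - \<gamma> * a) < 0"
        by simp
      then show "\<exists>y. (G has_real_derivative y) (at t) \<and> y < 0"
        using G_deriv[OF t] by blast
    qed (rule G_cont)
    then show ?thesis
      by (simp add: G_def u0)
  qed
qed

text \<open>
  A continuous function has a first zero after a positive start, because its set of zeros
  is closed; this makes the infimum in \<open>collapsing_time\<close> a minimum.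
\<close>

lemma collapsing_time_first_zero:
  assumes cont: "continuous_on {0..} u" and "u 0 > 0" and t: "t \<ge> 0" "u t = 0"
  shows "u (collapsing_time u) = 0" and "collapsing_time u > 0"
    and "\<And>s. 0 \<le> s \<Longrightarrow> s < collapsing_time u \<Longrightarrow> u s > 0"
proof -
  define Z where "Z = {t. 0 \<le> t \<and> u t = 0}"
  have "closed ({0..} \<inter> u -` {0})"
    using cont by (intro continuous_closed_preimage) auto
  also have "{0..} \<inter> u -` {0} = Z"
    by (auto simp: Z_def)
  finally have "closed Z" .
  moreover have "bdd_below Z"
    by (auto simp: Z_def intro!: bdd_belowI[of _ 0])
  moreover have "Z \<noteq> {}"
    using t by (auto simp: Z_def)
  ultimately have "collapsing_time u \<in> Z"
    using closed_contains_Inf[of Z] by (simp add: collapsing_time_def Z_def)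
  then show 0: "u (collapsing_time u) = 0" and "collapsing_time u > 0"
    using \<open>u 0 > 0\<close> by (auto simp: Z_def less_le)
  show "u s > 0" if s: "0 \<le> s" "s < collapsing_time u" for s
  proof (rule ccontr)
    assume "\<not> ?thesis"
    then obtain r where "0 \<le> r" "r \<le> s" "u r = 0"
      using IVT2'[of u s 0 0] continuous_on_subset[OF cont, of "{0..s}"] s \<open>u 0 > 0\<close> by auto
    then have "collapsing_time u \<le> r"
      using cInf_lower[OF _ \<open>bdd_below Z\<close>, of r] by (simp add: collapsing_time_def Z_def)
    with \<open>r \<le> s\<close> s show False
      by simp
  qed
qed

theorem proposition4p1:
  fixes a b L U v K W \<beta> \<gamma> :: real and u :: "real \<Rightarrow> real"
  assumes "a > 0" and "b \<ge> 0" and "L > 0" and "0 < U" and "U < L" and "v < 0"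
    and "fall_solution a b L U v u"
    and "v\<^sup>2 - a / U < 0"
    and "K = a" and "W = U" and "\<beta> = a / U - v\<^sup>2" and "\<gamma> = \<beta> / K"
  defines "V \<equiv> 1 / (K powr (1/2) * \<gamma> powr (3/2)) *
      (arcsin (sqrt (\<gamma> * W)) - sqrt (\<gamma> * W) * sqrt (1 - \<gamma> * W))"
  shows "(\<exists>t\<ge>0. u t = 0) \<and>
    collapsing_time u \<le> V \<and>
    (b > 0 \<longrightarrow> collapsing_time u < V)"
proof -
  have V: "V = free_fall_time a \<gamma> U"
    using assms by (simp add: V_def free_fall_time_def)
  have \<gamma>: "\<gamma> = (a / U - v\<^sup>2) / a" "\<gamma> > 0"
    using assms by auto
  have \<gamma>U: "\<gamma> * U < 1"
  proof -
    have "\<gamma> * U = 1 - U * v\<^sup>2 / a"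
      using \<gamma>(1) \<open>a > 0\<close> \<open>0 < U\<close> by (simp add: field_simps)
    then show ?thesis
      using \<open>a > 0\<close> \<open>0 < U\<close> \<open>v < 0\<close> by simp
  qed
  have cont: "continuous_on {0..} u" and u0: "u 0 = U"
    using \<open>fall_solution a b L U v u\<close> by (auto simp: fall_solution_def)
  note bound = fall_time_bound[OF \<open>a > 0\<close> \<open>b \<ge> 0\<close> \<open>0 < U\<close> \<open>U < L\<close> \<open>v < 0\<close>
      \<open>fall_solution a b L U v u\<close> \<gamma>]
  have "V > 0"
    unfolding V using assms(1,4) \<gamma>(2) \<gamma>U by (intro free_fall_time_pos)
  have ex: "\<exists>t\<ge>0. u t = 0"
  proof (rule ccontr)
    assume no_zero: "\<not> ?thesis"
    have pos: "u t > 0" if "t \<ge> 0" for t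
    proof (rule ccontr)
      assume "\<not> u t > 0"
      then show False
        using IVT2'[of u t 0 0] continuous_on_subset[OF cont, of "{0..t}"] that u0
          \<open>0 < U\<close> no_zero by auto
    qed
    have "u V < U" "free_fall_time a \<gamma> (u V) \<le> 0"
      using bound(1,2)[OF \<open>V > 0\<close>] pos V by auto
    moreover have "\<gamma> * u V < 1"
      using mult_strict_left_mono[OF \<open>u V < U\<close> \<gamma>(2)] \<gamma>U by simp
    ultimately show False
      using free_fall_time_pos[of a \<gamma> "u V"] \<open>a > 0\<close> \<gamma>(2) pos[of V] \<open>V > 0\<close> by simp
  qed
  then obtain t where "t \<ge> 0" "u t = 0"
    by blast
  note first = collapsing_time_first_zero[OF cont _ this]
  show ?thesis
    using ex bound(2,3)[of "collapsing_time u"] first u0 \<open>0 < U\<close> V by auto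
qed

end
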